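(* Let $X,Y$ be Banach spaces, let $A:D(A)\subset X\to X$ generate a $C_0$-semigroup $T(\cdot)$ on $X$, and let $C\in\mathcal L(X,Y)$. Suppose that the system $\dot x(t)=Ax(t)$, $y(t)=Cx(t)$ is UGESMO. Then it admits a coercive eOSS Lyapunov function in implication form. Moreover, this function can be chosen to be $1$-absolutely homogeneous, with linear Lyapunov gain and $p=1$. In particular, this applies if the system is eOSS.
   Context: $\mathcal L(X,Y)$ denotes the bounded linear operators from $X$ to $Y$. $\mathbb R_+=[0,\infty)$. $\mathcal K$ is the set of continuous strictly increasing $\gamma:\mathbb R_+\to\mathbb R_+$ with $\gamma(0)=0$, and $\mathcal K_\infty$ the set of unbounded $\gamma\in\mathcal K$. The mild solution with initial state $x\in X$ is $\phi(t,x)=T(t)x$ and the output trajectory is $y(t,x)=CT(t)x$, $t\ge0$. Lie derivative: $\dot V(x):=\limsup_{\tau\to+0}\frac{V(\phi(\tau,x))-V(x)}{\tau}$ (limsup in the extended real line), provided $t\mapsto V(\phi(t,x))$ is continuous at $t=0$. $V:X\to\mathbb R_+$ is a coercive eOSS Lyapunov function in implication form if: (a) there exist $k_1,k_2,p>0$ with $k_1\|x\|_X^p\le V(x)\le k_2\|x\|_X^p$ for all $x\in X$; (b) for every $x\in X$ the map $t\mapsto V(\phi(t,x))$, $t\ge0$, is continuous; (c') there exist $\tilde\alpha>0$ and $\chi\in\mathcal K_\infty$ such that, with $p$ as in (a), for every $x\in X$: $\|x\|_X\ge\chi(\|Cx\|_Y)\Rightarrow\dot V(x)\le-\tilde\alpha\|x\|_X^p$.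 It has linear Lyapunov gain if $\chi$ can be chosen linear. $V$ is $1$-absolutely homogeneous if $V(ax)=|a|V(x)$ for all $a\in\mathbb R$, $x\in X$. The system is eOSS (exponentially output-to-state stable) if there exist $M,\mu>0$ and $\gamma\in\mathcal K$ such that for all $x\in X$ and $t\ge0$: $\|\phi(t,x)\|_X\le Me^{-\mu t}\|x\|_X+\gamma\bigl(\max_{s\in[0,t]}\|y(s,x)\|_Y\bigr)$. The system is UGESMO (uniformly globally exponentially stable modulo output) if there exist $\rho>0$ and $M,\mu>0$ such that for all $x\in X$ and all $\tau\ge0$: if $\|\phi(t,x)\|_X\ge\rho\|y(t,x)\|_Y$ for all $t\in[0,\tau]$, then $\|\phi(t,x)\|_X\le Me^{-\mu t}\|x\|_X$ for all $t\in[0,\tau]$. *)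

theory Defs
  imports "HOL-Analysis.Analysis"
begin

text \<open>Only the restriction of \<open>T\<close> to \<open>[0, \<infinity>)\<close> is meaningful; nothing is said about negative times.\<close>

definition C0_semigroup :: "(real \<Rightarrow> 'a::banach \<Rightarrow>\<^sub>L 'a) \<Rightarrow> bool" where
  "C0_semigroup T \<longleftrightarrow>
     T 0 = id_blinfun \<and>
     (\<forall>s\<ge>0. \<forall>t\<ge>0. T (s + t) = T s o\<^sub>L T t) \<and>
     (\<forall>x. ((\<lambda>t. T t x) \<longlongrightarrow> x) (at_right 0))"

text \<open>The unbounded operator is given by its domain \<open>D\<close> together with a total function \<open>A\<close>
  whose values outside \<open>D\<close> are irrelevant.\<close>

definition generates_C0_semigroup ::
    "'a::banach set \<Rightarrow> ('a \<Rightarrow> 'a) \<Rightarrow> (real \<Rightarrow> 'a \<Rightarrow>\<^sub>L 'a) \<Rightarrow> bool" where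
  "generates_C0_semigroup D A T \<longleftrightarrow>
     C0_semigroup T \<and>
     D = {x. \<exists>l. ((\<lambda>h. (T h x - x) /\<^sub>R h) \<longlongrightarrow> l) (at_right 0)} \<and>
     (\<forall>x\<in>D. ((\<lambda>h. (T h x - x) /\<^sub>R h) \<longlongrightarrow> A x) (at_right 0))"

definition mild_solution :: "(real \<Rightarrow> 'a::banach \<Rightarrow>\<^sub>L 'a) \<Rightarrow> real \<Rightarrow> 'a \<Rightarrow> 'a" where
  "mild_solution T t x = T t x"

definition output_traj ::
    "(real \<Rightarrow> 'a::banach \<Rightarrow>\<^sub>L 'a) \<Rightarrow> ('a \<Rightarrow>\<^sub>L 'b::banach) \<Rightarrow> real \<Rightarrow> 'a \<Rightarrow> 'b" where
  "output_traj T C t x = C (T t x)"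

text \<open>Comparison functions live on \<open>[0, \<infinity>)\<close>; values at negative arguments are irrelevant.
  Nonnegativity on \<open>[0, \<infinity>)\<close> follows from monotonicity and \<open>\<gamma> 0 = 0\<close>.\<close>

definition class_K :: "(real \<Rightarrow> real) set" where
  "class_K = {\<gamma>. continuous_on {0..} \<gamma> \<and> strict_mono_on {0..} \<gamma> \<and> \<gamma> 0 = 0}"

definition class_K_inf :: "(real \<Rightarrow> real) set" where
  "class_K_inf = {\<gamma> \<in> class_K. \<not> bdd_above (\<gamma> ` {0..})}"

definition lie_derivative ::
    "(real \<Rightarrow> 'a::banach \<Rightarrow>\<^sub>L 'a) \<Rightarrow> ('a \<Rightarrow> real) \<Rightarrow> 'a \<Rightarrow> ereal" where
  "lie_derivative T V x =
     Limsup (at_right 0) (\<lambda>\<tau>. ereal ((V (mild_solution T \<tau> x) - V x) / \<tau>))"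

text \<open>The exponent \<open>p\<close> and the Lyapunov gain \<open>\<eta>\<close> are kept as parameters, since the same \<open>p\<close> occurs in
  the coercivity bounds and in the decay estimate, and since both get prescribed later.\<close>

definition eOSS_Lyapunov_impl_with ::
    "(real \<Rightarrow> 'a::banach \<Rightarrow>\<^sub>L 'a) \<Rightarrow> ('a \<Rightarrow>\<^sub>L 'b::banach) \<Rightarrow> real \<Rightarrow> (real \<Rightarrow> real) \<Rightarrow> ('a \<Rightarrow> real) \<Rightarrow> bool"
  where
  "eOSS_Lyapunov_impl_with T C p \<eta> V \<longleftrightarrow>
     (\<forall>x. 0 \<le> V x) \<and>
     p > 0 \<and>
     (\<exists>k\<^sub>1>0. \<exists>k\<^sub>2>0. \<forall>x. k\<^sub>1 * norm x powr p \<le> V x \<and> V x \<le> k\<^sub>2 * norm x powr p) \<and>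
     (\<forall>x. continuous_on {0..} (\<lambda>t. V (mild_solution T t x))) \<and>
     \<eta> \<in> class_K_inf \<and>
     (\<exists>\<alpha>>0. \<forall>x. norm x \<ge> \<eta> (norm (C x)) \<longrightarrow>
        lie_derivative T V x \<le> ereal (- \<alpha> * norm x powr p))"

definition coercive_eOSS_Lyapunov_impl ::
    "(real \<Rightarrow> 'a::banach \<Rightarrow>\<^sub>L 'a) \<Rightarrow> ('a \<Rightarrow>\<^sub>L 'b::banach) \<Rightarrow> ('a \<Rightarrow> real) \<Rightarrow> bool" where
  "coercive_eOSS_Lyapunov_impl T C V \<longleftrightarrow> (\<exists>p \<eta>. eOSS_Lyapunov_impl_with T C p \<eta> V)"

definition linear_gain :: "(real \<Rightarrow> real) \<Rightarrow> bool" where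
  "linear_gain \<eta> \<longleftrightarrow> (\<exists>r. \<forall>s\<ge>0. \<eta> s = r * s)"

definition abs_homogeneous_1 :: "('a::real_vector \<Rightarrow> real) \<Rightarrow> bool" where
  "abs_homogeneous_1 V \<longleftrightarrow> (\<forall>a x. V (a *\<^sub>R x) = \<bar>a\<bar> * V x)"

text \<open>The supremum over \<open>[0, t]\<close> is a maximum, because the output trajectory is continuous.\<close>

definition eOSS :: "(real \<Rightarrow> 'a::banach \<Rightarrow>\<^sub>L 'a) \<Rightarrow> ('a \<Rightarrow>\<^sub>L 'b::banach) \<Rightarrow> bool" where
  "eOSS T C \<longleftrightarrow>
     (\<exists>M>0. \<exists>\<mu>>0. \<exists>\<gamma>\<in>class_K. \<forall>x. \<forall>t\<ge>0.
        norm (mild_solution T t x)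
          \<le> M * exp (- \<mu> * t) * norm x + \<gamma> (SUP s\<in>{0..t}. norm (output_traj T C s x)))"

definition UGESMO :: "(real \<Rightarrow> 'a::banach \<Rightarrow>\<^sub>L 'a) \<Rightarrow> ('a \<Rightarrow>\<^sub>L 'b::banach) \<Rightarrow> bool" where
  "UGESMO T C \<longleftrightarrow>
     (\<exists>\<rho>>0. \<exists>M>0. \<exists>\<mu>>0. \<forall>x. \<forall>\<tau>\<ge>0.
        (\<forall>t\<in>{0..\<tau>}. norm (mild_solution T t x) \<ge> \<rho> * norm (output_traj T C t x)) \<longrightarrow>
        (\<forall>t\<in>{0..\<tau>}. norm (mild_solution T t x) \<le> M * exp (- \<mu> * t) * norm x))"

end

theory Submission
  imports Defs
begin

text \<open>
  Write \<open>x(t) = T t x\<close>. Along trajectories with small output the system decays like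
  \<open>M exp (- \<mu> t)\<close>, and the classical converse Lyapunov function would be the supremum of
  \<open>exp (\<mu> t) \<parallel>x(t)\<parallel>\<close> over the future. Two things go wrong: after the output has become large
  nothing bounds this supremum, and cutting it off at the first time of large output makes it
  jump along trajectories, since that time does not depend continuously on the state.

  Both defects disappear if the future is not cut off but charged for the output met on the way.
  Let \<open>p(z) = M max 0 (2 \<rho> \<parallel>C z\<parallel> - \<parallel>z\<parallel>)\<close>, a continuous, \<open>1\<close>-homogeneous function that vanishes
  where the output is small, and put
  \<open>V(x) = max \<parallel>x\<parallel> (sup\<^sub>t (exp (\<mu> t) \<parallel>x(t)\<parallel> - sup\<^sub>s (exp (\<mu> s) p(x(s)))))\<close>,
  where \<open>t\<close> ranges over \<open>[0, \<infinity>)\<close> and \<open>s\<close> over \<open>[0, t]\<close>.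
  The inner supremum, unlike an integral, also sees very short bursts of output: such bursts
  cannot be excluded, because \<open>t \<mapsto> C (T t x)\<close> has in general no modulus of continuity that is
  uniform over the unit ball.

  \<^item> \<open>V \<le> M \<parallel>\<cdot>\<parallel>\<close> (\<open>penalised_le_norm\<close>): consider the last time \<open>s \<le> t\<close> at which
    \<open>\<parallel>x(s)\<parallel> \<le> \<rho> \<parallel>C x(s)\<parallel>\<close>. The charge at \<open>s\<close> is at least \<open>M exp (\<mu> s) \<parallel>x(s)\<parallel>\<close>, which by decay
    on \<open>[s, t]\<close> is at least \<open>exp (\<mu> t) \<parallel>x(t)\<parallel>\<close>. If there is no such time, decay from \<open>0\<close> gives
    the bound directly.
  \<^item> \<open>V\<close> is continuous along trajectories (\<open>penalised_sup_continuous_on\<close>): moving the starting time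
    changes the supremum by at most the oscillation of the data over the skipped interval.
  \<^item> If \<open>\<parallel>x\<parallel> \<ge> 3 \<rho> \<parallel>C x\<parallel>\<close>, no charge is made for a short while, so dropping that piece of the
    past only rescales time and \<open>V(x(h)) \<le> exp (- \<mu> h) V(x)\<close> for small \<open>h\<close>
    (\<open>lyapunov_decrease\<close>). The gain is \<open>3 \<rho>\<close> rather than \<open>2 \<rho>\<close> because strict inequality is
    what persists for small times.

  Output-to-state stability implies stability modulo output by a small-gain argument: linearity
  of the system makes the gain linear (\<open>eOSS_linear_gain\<close>), and for large \<open>\<rho>\<close> the output term is
  absorbed, so that the state is halved within a fixed time (\<open>eOSS_imp_UGESMO\<close>).
\<close>

section \<open>Strong continuity of the semigroup\<close>

text \<open>Each orbit is bounded near time \<open>0\<close>, but over a time and by a bound that depend on the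
  starting point. The closed sets on which a common time and bound work cover the space, so by
  Baire's theorem one of them contains a ball, and differences of points of that ball reach all
  directions.\<close>

lemma C0_semigroup_locally_bounded:
  fixes T :: "real \<Rightarrow> 'a::banach \<Rightarrow>\<^sub>L 'a"
  assumes "C0_semigroup T"
  shows "\<exists>\<delta>>0. \<exists>N. \<forall>t\<in>{0..\<delta>}. norm (T t) \<le> N"
proof -
  have T0: "T 0 = id_blinfun" and Tlim: "((\<lambda>t. T t x) \<longlongrightarrow> x) (at_right 0)" for x
    using assms by (auto simp: C0_semigroup_def)
  define G where "G n = {x. \<forall>t\<in>{0..1 / real (Suc n)}. norm (T t x) \<le> real n}" for n
  have G_closed: "closed (G n)" for n
  proof -
    have "G n = (\<Inter>t\<in>{0..1 / real (Suc n)}. {x. norm (T t x) \<le> real n})"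
      by (auto simp: G_def)
    then show ?thesis
      by (auto intro!: closed_INT closed_Collect_le continuous_intros)
  qed
  have G_cover: "\<exists>n. x \<in> G n" for x
  proof -
    have "eventually (\<lambda>t. dist (T t x) x < 1) (at_right 0)"
      using Tlim[of x] by (rule tendstoD) simp
    then obtain d where d: "d > 0" "\<And>t. 0 < t \<Longrightarrow> t < d \<Longrightarrow> dist (T t x) x < 1"
      by (auto simp: eventually_at_right_field)
    obtain n1 where n1: "1 / real (Suc n1) < d"
      using d(1) nat_approx_posE by blast
    obtain n2 where n2: "norm x + 1 \<le> real n2"
      using real_arch_simple by blast
    have "x \<in> G (max n1 n2)"
      unfolding G_def
    proof safe
      fix t assume t: "t \<in> {0..1 / real (Suc (max n1 n2))}"
      have "1 / real (Suc (max n1 n2)) \<le> 1 / real (Suc n1)"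
        by (intro divide_left_mono) auto
      then have "t < d" using t n1 by auto
      have "norm (T t x) \<le> norm x + 1"
      proof (cases "t = 0")
        case True then show ?thesis by (simp add: T0)
      next
        case False
        then have "dist (T t x) x < 1" using d(2) t \<open>t < d\<close> by auto
        then show ?thesis
          using norm_triangle_ineq2[of "T t x" x] by (simp add: dist_norm)
      qed
      then show "norm (T t x) \<le> real (max n1 n2)" using n2 by simp
    qed
    then show ?thesis by blast
  qed
  have "\<exists>n. interior (G n) \<noteq> {}"
  proof (rule ccontr)
    assume *: "\<not> ?thesis"
    have "Met_TC.mtopology interior_of \<Union>(range G) = {}"
      by (rule Met_TC.metric_Baire_category_alt) (use * G_closed complete_UNIV in auto)
    moreover have "\<Union>(range G) = UNIV" using G_cover by auto
    ultimately show False by simp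
  qed
  then obtain n z where "z \<in> interior (G n)" by blast
  then obtain e where e: "e > 0" "cball z e \<subseteq> G n"
    by (meson mem_interior_cball)
  have "norm (T t) \<le> 2 * real n / e" if t: "t \<in> {0..1 / real (Suc n)}" for t
  proof (rule norm_blinfun_bound)
    fix x
    show "norm (T t x) \<le> 2 * real n / e * norm x"
    proof (cases "x = 0")
      case False
      define h where "h = (e / norm x) *\<^sub>R x"
      have "norm h = e" using False e(1) by (simp add: h_def)
      then have "z + h \<in> G n" "z \<in> G n"
        using e by (auto simp: subset_iff dist_norm)
      then have "norm (T t (z + h)) \<le> real n" "norm (T t z) \<le> real n"
        using t by (auto simp: G_def)
      moreover have "T t h = T t (z + h) - T t z"
        by (simp add: blinfun.add_right)
      ultimately have "norm (T t h) \<le> 2 * real n"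
        using norm_triangle_ineq4[of "T t (z + h)" "T t z"] by simp
      moreover have "norm (T t h) = e / norm x * norm (T t x)"
        using e(1) by (simp add: h_def blinfun.scaleR_right)
      ultimately show ?thesis using False e(1) by (simp add: field_simps)
    qed simp
  qed (use e in auto)
  then show ?thesis
    by (intro exI[of _ "1 / real (Suc n)"] conjI exI[of _ "2 * real n / e"] ballI) auto
qed

lemma C0_semigroup_shift:
  assumes "C0_semigroup T" "s \<ge> 0" "t \<ge> 0"
  shows "T (s + t) x = T s (T t x)"
  using assms by (auto simp: C0_semigroup_def)

text \<open>Continuity from the left needs the local bound: the increment over \<open>[t - h, t]\<close> is
  \<open>T (t - h)\<close> applied to the increment over \<open>[0, h]\<close>, and \<open>T (t - h)\<close> has to stay bounded as
  \<open>h\<close> tends to \<open>0\<close>.\<close>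

lemma C0_semigroup_continuous_on:
  fixes T :: "real \<Rightarrow> 'a::banach \<Rightarrow>\<^sub>L 'a"
  assumes T: "C0_semigroup T"
  shows "continuous_on {0..} (\<lambda>t. T t x)"
proof -
  have Tlim: "((\<lambda>t. T t x) \<longlongrightarrow> x) (at_right 0)"
    using T by (auto simp: C0_semigroup_def)
  have right: "((\<lambda>s. T s x) \<longlongrightarrow> T t x) (at_right t)" if "t \<ge> 0" for t
  proof -
    have "((\<lambda>h. T t (T h x)) \<longlongrightarrow> T t x) (at_right 0)"
      by (intro tendsto_intros Tlim)
    moreover have "eventually (\<lambda>h. T t (T h x) = T (h + t) x) (at_right 0)"
      using eventually_at_right_less[of 0]
      by eventually_elim (simp add: C0_semigroup_shift[OF T that, symmetric] add.commute)
    ultimately have "((\<lambda>h. T (h + t) x) \<longlongrightarrow> T t x) (at_right 0)"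
      by (rule Lim_transform_eventually)
    then show ?thesis by (rule filterlim_at_right_to_0[THEN iffD2])
  qed
  have left: "((\<lambda>s. T s x) \<longlongrightarrow> T t x) (at_left t)" if "t > 0" for t
  proof -
    obtain \<delta> N where \<delta>: "\<delta> > 0" "\<And>t. t \<in> {0..\<delta>} \<Longrightarrow> norm (T t) \<le> N"
      using C0_semigroup_locally_bounded[OF T] by blast
    define d where "d = min \<delta> t"
    have d: "0 < d" "d \<le> \<delta>" "d \<le> t" using \<delta> that by (auto simp: d_def)
    define K where "K = norm (T (t - d)) * N"
    have K: "norm (T s) \<le> K" if s: "s \<in> {t - d..t}" for s
    proof -
      have "T s = T (t - d) o\<^sub>L T (s - (t - d))"
        using T s d unfolding C0_semigroup_def
        by (metis add.commute atLeastAtMost_iff diff_add_cancel diff_ge_0_iff_ge)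
      then have "norm (T s) \<le> norm (T (t - d)) * norm (T (s - (t - d)))"
        by (simp add: norm_blinfun_compose)
      also have "\<dots> \<le> K"
        unfolding K_def using s d by (intro mult_left_mono \<delta>(2)) auto
      finally show ?thesis .
    qed
    have "((\<lambda>h. K * norm (T h x - x)) \<longlongrightarrow> K * norm (x - x)) (at_right 0)"
      by (intro tendsto_intros Tlim)
    then have "((\<lambda>h. K * norm (T h x - x)) \<longlongrightarrow> 0) (at_right 0)" by simp
    moreover have "eventually (\<lambda>h. norm (T (t - h) x - T t x) \<le> K * norm (T h x - x)) (at_right 0)"
      using eventually_at_right_less[of 0] eventually_at_right_real[OF d(1)]
    proof eventually_elim
      case (elim h)
      then have "T t x = T (t - h) (T h x)"
        using C0_semigroup_shift[OF T, of "t - h" h x] d by auto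
      then have "norm (T (t - h) x - T t x) = norm (T (t - h) (T h x - x))"
        by (simp add: blinfun.diff_right norm_minus_commute)
      also have "\<dots> \<le> norm (T (t - h)) * norm (T h x - x)"
        by (rule norm_blinfun)
      also have "\<dots> \<le> K * norm (T h x - x)"
        using elim d by (intro mult_right_mono K) auto
      finally show ?case .
    qed
    ultimately have "((\<lambda>h. T (t - h) x - T t x) \<longlongrightarrow> 0) (at_right 0)"
      by (rule Lim_null_comparison[rotated])
    then have "((\<lambda>h. T (t - h) x) \<longlongrightarrow> T t x) (at_right 0)"
      by (rule LIM_zero_cancel)
    moreover have "at_left t = filtermap (\<lambda>h. t - h) (at_right 0)"
      by (simp add: at_left_minus[of t] at_right_to_0[of "- t"] filtermap_filtermap)
    ultimately show ?thesis by (simp only: filterlim_filtermap)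
  qed
  show ?thesis
    unfolding continuous_on_def
  proof (intro ballI)
    fix t :: real assume "t \<in> {0..}"
    show "((\<lambda>s. T s x) \<longlongrightarrow> T t x) (at t within {0..})"
    proof (cases "t = 0")
      case True
      then show ?thesis using right[of 0] by (simp add: at_within_Ici_at_right)
    next
      case False
      then have "t > 0" using \<open>t \<in> {0..}\<close> by auto
      then have "((\<lambda>s. T s x) \<longlongrightarrow> T t x) (at t)"
        using left right by (simp add: filterlim_split_at)
      then show ?thesis by (rule tendsto_within_subset) simp
    qed
  qed
qed

section \<open>Suprema over the future minus a running supremum\<close>

lemma SUP_mult_left_real:
  fixes f :: "'i \<Rightarrow> real"
  assumes "c \<ge> 0" "S \<noteq> {}" "bdd_above (f ` S)"
  shows "(SUP i\<in>S. c * f i) = c * (SUP i\<in>S. f i)"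
proof (cases "c = 0")
  case False
  then have c: "c > 0" using assms by simp
  show ?thesis
  proof (rule antisym)
    show "(SUP i\<in>S. c * f i) \<le> c * (SUP i\<in>S. f i)"
      using assms by (intro cSUP_least mult_left_mono cSUP_upper) auto
    have bdd: "bdd_above ((\<lambda>i. c * f i) ` S)"
      using assms(1,3) by (auto simp: bdd_above_def intro!: mult_left_mono)
    have "(SUP i\<in>S. f i) \<le> (SUP i\<in>S. c * f i) / c"
    proof (rule cSUP_least)
      fix i assume "i \<in> S"
      then have "c * f i \<le> (SUP i\<in>S. c * f i)" using bdd by (rule cSUP_upper)
      then show "f i \<le> (SUP i\<in>S. c * f i) / c" using c by (simp add: field_simps)
    qed (fact assms)
    then show "c * (SUP i\<in>S. f i) \<le> (SUP i\<in>S. c * f i)"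
      using c by (simp add: field_simps)
  qed
qed (use assms in simp)

lemma continuous_on_imp_bdd_above_image:
  fixes g :: "real \<Rightarrow> real"
  assumes "continuous_on {0..} g" "a \<ge> 0"
  shows "bdd_above (g ` {a..b})"
  using assms
  by (intro bounded_imp_bdd_above compact_imp_bounded compact_continuous_image
        continuous_on_subset[OF assms(1)]) auto

text \<open>For a reward \<open>f\<close> and a charge \<open>g\<close>, the payoff of running from \<open>s\<close> to \<open>t\<close>: the final
  reward minus the largest charge met on the way.\<close>

definition penalised :: "(real \<Rightarrow> real) \<Rightarrow> (real \<Rightarrow> real) \<Rightarrow> real \<Rightarrow> real \<Rightarrow> real" where
  "penalised f g s t = f t - (SUP u\<in>{s..t}. g u)"

definition penalised_sup :: "(real \<Rightarrow> real) \<Rightarrow> (real \<Rightarrow> real) \<Rightarrow> real \<Rightarrow> real" where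
  "penalised_sup f g s = (SUP t\<in>{s..}. penalised f g s t)"

lemma penalised_sup_upper:
  assumes "bdd_above (penalised f g s ` {s..})" "t \<ge> s"
  shows "penalised f g s t \<le> penalised_sup f g s"
  unfolding penalised_sup_def using assms by (intro cSUP_upper) auto

lemma penalised_sup_least:
  assumes "\<And>t. t \<ge> s \<Longrightarrow> penalised f g s t \<le> B"
  shows "penalised_sup f g s \<le> B"
  unfolding penalised_sup_def using assms by (intro cSUP_least) auto

lemma penalised_self: "penalised f g s s = f s - g s"
  by (simp add: penalised_def)

lemma penalised_scale:
  assumes "continuous_on {0..} g" "c \<ge> 0" "0 \<le> s" "s \<le> t"
  shows "penalised (\<lambda>t. c * f t) (\<lambda>t. c * g t) s t = c * penalised f g s t"
  unfolding penalised_def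
  using assms continuous_on_imp_bdd_above_image[of g s t]
  by (subst SUP_mult_left_real) (auto simp: algebra_simps)

lemma penalised_sup_scale:
  assumes "continuous_on {0..} g" "c \<ge> 0" "0 \<le> s" "bdd_above (penalised f g s ` {s..})"
  shows "penalised_sup (\<lambda>t. c * f t) (\<lambda>t. c * g t) s = c * penalised_sup f g s"
proof -
  have "penalised_sup (\<lambda>t. c * f t) (\<lambda>t. c * g t) s = (SUP t\<in>{s..}. c * penalised f g s t)"
    unfolding penalised_sup_def using assms by (intro SUP_cong refl penalised_scale) auto
  also have "\<dots> = c * penalised_sup f g s"
    unfolding penalised_sup_def using assms by (intro SUP_mult_left_real) auto
  finally show ?thesis .
qed

lemma penalised_shift:
  "penalised (\<lambda>t. f (s + t)) (\<lambda>t. g (s + t)) 0 t = penalised f g s (s + t)"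
proof -
  have "(\<lambda>u. g (s + u)) ` {0..t} = g ` ((+) s ` {0..t})" by (simp only: image_image)
  then show ?thesis by (simp add: penalised_def add.commute)
qed

lemma penalised_sup_shift:
  "penalised_sup (\<lambda>t. f (s + t)) (\<lambda>t. g (s + t)) 0 = penalised_sup f g s"
proof -
  have "(\<lambda>t. penalised f g s (s + t)) ` {0..} = penalised f g s ` ((+) s ` {0..})"
    by (simp only: image_image)
  then show ?thesis by (simp add: penalised_sup_def penalised_shift)
qed

lemma penalised_sup_cong:
  assumes "\<And>t. t \<ge> s \<Longrightarrow> f t = f' t" "\<And>t. t \<ge> s \<Longrightarrow> g t = g' t"
  shows "penalised_sup f g s = penalised_sup f' g' s"
  unfolding penalised_sup_def penalised_def using assms
  by (intro SUP_cong refl arg_cong2[where f = "(-)"]) auto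

text \<open>Starting later at \<open>s'\<close> forgets the charges on \<open>[s, s']\<close>, which exceed the charge at \<open>s'\<close>
  by at most \<open>\<epsilon>\<close>. Starting earlier admits the additional final times in \<open>[s, s']\<close>; their payoff is
  at most \<open>f - g\<close> at that time, hence close to the payoff of stopping at once at \<open>s'\<close>.\<close>

lemma penalised_sup_oscillation:
  assumes cont: "continuous_on {0..} g"
    and bdd: "\<And>s. s \<ge> 0 \<Longrightarrow> bdd_above (penalised f g s ` {s..})"
    and s: "0 \<le> s" "s \<le> s'"
    and osc_g: "\<And>u. u \<in> {s..s'} \<Longrightarrow> g u \<le> g s' + \<epsilon>"
    and osc_fg: "\<And>u. u \<in> {s..s'} \<Longrightarrow> f u - g u \<le> f s' - g s' + \<epsilon>"
  shows "\<bar>penalised_sup f g s - penalised_sup f g s'\<bar> \<le> \<epsilon>"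
proof -
  have \<epsilon>: "\<epsilon> \<ge> 0" using osc_g[of s'] s by simp
  have bdd_g: "bdd_above (g ` {a..b})" if "a \<ge> 0" for a b
    using cont that by (rule continuous_on_imp_bdd_above_image)
  have "penalised_sup f g s \<le> penalised_sup f g s' + \<epsilon>"
  proof (rule penalised_sup_least)
    fix t assume "t \<ge> s"
    show "penalised f g s t \<le> penalised_sup f g s' + \<epsilon>"
    proof (cases "t \<ge> s'")
      case True
      have "(SUP u\<in>{s'..t}. g u) \<le> (SUP u\<in>{s..t}. g u)"
        using True s by (intro cSUP_subset_mono bdd_g) auto
      then have "penalised f g s t \<le> penalised f g s' t" by (simp add: penalised_def)
      also have "\<dots> \<le> penalised_sup f g s'"
        using True s by (intro penalised_sup_upper bdd) auto
      finally show ?thesis using \<epsilon> by simp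
    next
      case False
      have "g t \<le> (SUP u\<in>{s..t}. g u)"
        using \<open>t \<ge> s\<close> s by (intro cSUP_upper bdd_g) auto
      then have "penalised f g s t \<le> f t - g t" by (simp add: penalised_def)
      also have "\<dots> \<le> penalised f g s' s' + \<epsilon>"
        using osc_fg[of t] False \<open>t \<ge> s\<close> by (simp add: penalised_self)
      also have "\<dots> \<le> penalised_sup f g s' + \<epsilon>"
        using s by (intro add_right_mono penalised_sup_upper bdd) auto
      finally show ?thesis .
    qed
  qed
  moreover have "penalised_sup f g s' \<le> penalised_sup f g s + \<epsilon>"
  proof (rule penalised_sup_least)
    fix t assume t: "t \<ge> s'"
    have "(SUP u\<in>{s..t}. g u) \<le> (SUP u\<in>{s'..t}. g u) + \<epsilon>"
    proof (rule cSUP_least)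
      fix u assume u: "u \<in> {s..t}"
      have upper: "g v \<le> (SUP u\<in>{s'..t}. g u)" if "v \<in> {s'..t}" for v
        using that s by (intro cSUP_upper bdd_g) auto
      show "g u \<le> (SUP u\<in>{s'..t}. g u) + \<epsilon>"
        using upper[of u] upper[of s'] osc_g[of u] u t \<epsilon> by (cases "u \<ge> s'") auto
    qed (use s t in auto)
    then have "penalised f g s' t \<le> penalised f g s t + \<epsilon>" by (simp add: penalised_def)
    also have "\<dots> \<le> penalised_sup f g s + \<epsilon>"
      using s t by (intro add_right_mono penalised_sup_upper bdd) auto
    finally show "penalised f g s' t \<le> penalised_sup f g s + \<epsilon>" .
  qed
  ultimately show ?thesis by linarith
qed

lemma penalised_sup_continuous_on:
  assumes f: "continuous_on {0..} f" and g: "continuous_on {0..} g"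
    and bdd: "\<And>s. s \<ge> 0 \<Longrightarrow> bdd_above (penalised f g s ` {s..})"
  shows "continuous_on {0..} (penalised_sup f g)"
  unfolding continuous_on_iff
proof (intro ballI allI impI)
  fix s e :: real assume s: "s \<in> {0..}" and e: "e > 0"
  have fg: "continuous_on {0..} (\<lambda>u. f u - g u)" by (intro continuous_intros f g)
  obtain d1 where d1: "d1 > 0" "\<And>u. u \<ge> 0 \<Longrightarrow> \<bar>u - s\<bar> < d1 \<Longrightarrow> \<bar>g u - g s\<bar> < e / 4"
    using g[unfolded continuous_on_iff, rule_format, OF s, of "e / 4"] e
    by (auto simp: dist_real_def)
  obtain d2 where d2: "d2 > 0"
    "\<And>u. u \<ge> 0 \<Longrightarrow> \<bar>u - s\<bar> < d2 \<Longrightarrow> \<bar>(f u - g u) - (f s - g s)\<bar> < e / 4"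
    using fg[unfolded continuous_on_iff, rule_format, OF s, of "e / 4"] e
    by (auto simp: dist_real_def)
  have near: "\<bar>penalised_sup f g a - penalised_sup f g b\<bar> \<le> e / 2"
    if "0 \<le> a" "a \<le> b" "\<bar>a - s\<bar> < min d1 d2" "\<bar>b - s\<bar> < min d1 d2" for a b
  proof (rule penalised_sup_oscillation[OF g bdd that(1,2)])
    fix u assume u: "u \<in> {a..b}"
    then have u': "u \<ge> 0" "\<bar>u - s\<bar> < min d1 d2" "b \<ge> 0" using that by auto
    have "\<bar>g u - g s\<bar> < e / 4" "\<bar>g b - g s\<bar> < e / 4"
      using u' that d1(2)[of u] d1(2)[of b] by auto
    then show "g u \<le> g b + e / 2" by linarith
    have "\<bar>(f u - g u) - (f s - g s)\<bar> < e / 4" "\<bar>(f b - g b) - (f s - g s)\<bar> < e / 4"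
      using u' that d2(2)[of u] d2(2)[of b] by auto
    then show "f u - g u \<le> f b - g b + e / 2" by linarith
  qed
  show "\<exists>d>0. \<forall>s'\<in>{0..}. dist s' s < d \<longrightarrow> dist (penalised_sup f g s') (penalised_sup f g s) < e"
  proof (intro exI[of _ "min d1 d2"] conjI ballI impI)
    show "min d1 d2 > 0" using d1 d2 by simp
    fix s' :: real assume "s' \<in> {0..}" "dist s' s < min d1 d2"
    then have "\<bar>penalised_sup f g s' - penalised_sup f g s\<bar> \<le> e / 2"
      using near[of s s'] near[of s' s] s d1(1) d2(1)
      by (cases "s \<le> s'") (auto simp: dist_real_def abs_minus_commute)
    then show "dist (penalised_sup f g s') (penalised_sup f g s) < e"
      using e by (simp add: dist_real_def)
  qed
qed

lemma penalised_sup_antimono_while_free: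
  assumes g: "continuous_on {0..} g" and nonneg: "\<And>u. u \<ge> 0 \<Longrightarrow> 0 \<le> g u"
    and bdd: "bdd_above (penalised f g 0 ` {0..})"
    and h: "0 \<le> h" and free: "\<And>u. u \<in> {0..h} \<Longrightarrow> g u = 0"
  shows "penalised_sup f g h \<le> penalised_sup f g 0"
proof (rule penalised_sup_least)
  fix t assume t: "t \<ge> h"
  have "(SUP u\<in>{0..t}. g u) \<le> (SUP u\<in>{h..t}. g u)"
  proof (rule cSUP_least)
    fix u assume u: "u \<in> {0..t}"
    have upper: "g v \<le> (SUP u\<in>{h..t}. g u)" if "v \<in> {h..t}" for v
      using that h by (intro cSUP_upper continuous_on_imp_bdd_above_image g) auto
    show "g u \<le> (SUP u\<in>{h..t}. g u)"
      using upper[of u] upper[of h] free[of u] nonneg[of h] u t h by (cases "u \<ge> h") auto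
  qed (use h t in auto)
  then have "penalised f g h t \<le> penalised f g 0 t" by (simp add: penalised_def)
  also have "\<dots> \<le> penalised_sup f g 0" using h t bdd by (intro penalised_sup_upper) auto
  finally show "penalised f g h t \<le> penalised_sup f g 0" .
qed

section \<open>The Lyapunov function\<close>

lemma linear_class_K_inf:
  assumes "c > 0"
  shows "(\<lambda>s::real. c * s) \<in> class_K_inf"
proof -
  have "\<not> bdd_above ((\<lambda>s. c * s) ` {0..})"
  proof
    assume "bdd_above ((\<lambda>s. c * s) ` {0..})"
    then obtain B where B: "\<And>s. s \<ge> 0 \<Longrightarrow> c * s \<le> B" by (auto simp: bdd_above_def)
    have "c * ((\<bar>B\<bar> + 1) / c) \<le> B" using assms by (intro B) auto
    then show False using assms by simp
  qed
  then show ?thesis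
    using assms
    by (auto simp: class_K_inf_def class_K_def strict_mono_on_def intro!: continuous_intros)
qed

text \<open>Stability modulo output with its constants fixed. Enlarging \<open>M\<close> is harmless, so \<open>M \<ge> 1\<close> is
  no loss; it makes the penalty below dominate the state itself, also when \<open>M\<close> was small.\<close>

locale exp_stable_modulo_output =
  fixes T :: "real \<Rightarrow> 'a::banach \<Rightarrow>\<^sub>L 'a" and C :: "'a \<Rightarrow>\<^sub>L 'b::banach"
    and \<rho> M \<mu> :: real
  assumes semigroup: "C0_semigroup T"
    and rho_pos: "\<rho> > 0" and M_ge_1: "M \<ge> 1" and mu_pos: "\<mu> > 0"
    and decay: "\<And>x t. t \<ge> 0 \<Longrightarrow>
      (\<And>s. s \<in> {0..t} \<Longrightarrow> \<rho> * norm (C (T s x)) \<le> norm (T s x)) \<Longrightarrow>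
      norm (T t x) \<le> M * exp (- \<mu> * t) * norm x"
begin

text \<open>The coefficient \<open>2 \<rho>\<close> leaves room on both sides: the penalty is at least \<open>M \<parallel>z\<parallel>\<close> where
  \<open>\<parallel>z\<parallel> \<le> \<rho> \<parallel>C z\<parallel>\<close>, and vanishes in a neighbourhood of every \<open>z \<noteq> 0\<close> with \<open>\<parallel>z\<parallel> \<ge> 3 \<rho> \<parallel>C z\<parallel>\<close>.\<close>

definition output_penalty :: "'a \<Rightarrow> real" where
  "output_penalty z = M * max 0 (2 * \<rho> * norm (C z) - norm z)"

definition weighted_norm :: "'a \<Rightarrow> real \<Rightarrow> real" where
  "weighted_norm x t = exp (\<mu> * t) * norm (T t x)"

definition weighted_penalty :: "'a \<Rightarrow> real \<Rightarrow> real" where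
  "weighted_penalty x t = exp (\<mu> * t) * output_penalty (T t x)"

text \<open>The maximum with the norm enforces coercivity at states of large output, where the supremum
  may even be negative. At states of small output it changes nothing, since stopping at once is
  then free of charge and already pays \<open>\<parallel>x\<parallel>\<close>.\<close>

definition lyapunov :: "'a \<Rightarrow> real" where
  "lyapunov x = max (norm x) (penalised_sup (weighted_norm x) (weighted_penalty x) 0)"

lemma T_0 [simp]: "T 0 x = x"
  using semigroup by (simp add: C0_semigroup_def)

lemmas shift = C0_semigroup_shift[OF semigroup]
lemmas trajectory_continuous = C0_semigroup_continuous_on[OF semigroup]

lemma output_penalty_nonneg: "0 \<le> output_penalty z"
  using M_ge_1 by (simp add: output_penalty_def)

lemma output_penalty_scaleR: "output_penalty (a *\<^sub>R z) = \<bar>a\<bar> * output_penalty z"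
proof -
  have "max 0 (2 * \<rho> * (\<bar>a\<bar> * norm (C z)) - \<bar>a\<bar> * norm z)
      = \<bar>a\<bar> * max 0 (2 * \<rho> * norm (C z) - norm z)"
    by (subst max_mult_distrib_left) (simp add: algebra_simps)
  then show ?thesis by (simp add: output_penalty_def blinfun.scaleR_right)
qed

lemma weighted_norm_continuous: "continuous_on {0..} (weighted_norm x)"
  unfolding weighted_norm_def by (intro continuous_intros trajectory_continuous)

lemma weighted_penalty_continuous: "continuous_on {0..} (weighted_penalty x)"
  unfolding weighted_penalty_def output_penalty_def
  by (intro continuous_intros trajectory_continuous)

lemma weighted_penalty_nonneg: "0 \<le> weighted_penalty x t"
  by (simp add: weighted_penalty_def output_penalty_nonneg)

lemma exp_weight_shift: "exp (- \<mu> * s) * exp (\<mu> * (s + t)) = exp (\<mu> * t)"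
  by (simp add: algebra_simps flip: exp_add)

lemma weighted_norm_shift:
  "s \<ge> 0 \<Longrightarrow> t \<ge> 0 \<Longrightarrow> weighted_norm (T s x) t = exp (- \<mu> * s) * weighted_norm x (s + t)"
  by (simp only: weighted_norm_def shift[of t s, symmetric] add.commute[of t s] exp_weight_shift
      mult.assoc[symmetric])

lemma weighted_penalty_shift:
  "s \<ge> 0 \<Longrightarrow> t \<ge> 0 \<Longrightarrow> weighted_penalty (T s x) t = exp (- \<mu> * s) * weighted_penalty x (s + t)"
  by (simp only: weighted_penalty_def shift[of t s, symmetric] add.commute[of t s] exp_weight_shift
      mult.assoc[symmetric])

lemma decay_from:
  assumes "0 \<le> s" "s \<le> t"
    and "\<And>u. u \<in> {s..t} \<Longrightarrow> \<rho> * norm (C (T u x)) \<le> norm (T u x)"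
  shows "weighted_norm x t \<le> M * weighted_norm x s"
proof -
  have sh: "T r (T s x) = T (s + r) x" if "r \<ge> 0" for r
    by (metis shift add.commute assms(1) that)
  have "norm (T (t - s) (T s x)) \<le> M * exp (- \<mu> * (t - s)) * norm (T s x)"
  proof (rule decay)
    show "\<rho> * norm (C (T r (T s x))) \<le> norm (T r (T s x))" if "r \<in> {0..t - s}" for r
      using that assms(3)[of "s + r"] by (simp add: sh)
  qed (use assms in simp)
  then have "exp (\<mu> * t) * norm (T t x)
      \<le> exp (\<mu> * t) * (M * exp (- \<mu> * (t - s)) * norm (T s x))"
    using sh[of "t - s"] assms by (intro mult_left_mono) auto
  also have "\<dots> = M * (exp (\<mu> * t + - \<mu> * (t - s)) * norm (T s x))"
    unfolding exp_add by (simp only: mult_ac)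
  also have "\<mu> * t + - \<mu> * (t - s) = \<mu> * s" by (simp add: algebra_simps)
  finally show ?thesis by (simp add: weighted_norm_def)
qed

text \<open>The last time of large output, if there is one, charges more than all that can be
  gained afterwards; this is where decay modulo output enters.\<close>

lemma penalised_le_norm:
  assumes t: "t \<ge> 0"
  shows "penalised (weighted_norm x) (weighted_penalty x) 0 t \<le> M * norm x"
proof -
  let ?k = "\<lambda>s. norm (T s x) - \<rho> * norm (C (T s x))"
  let ?sup = "SUP u\<in>{0..t}. weighted_penalty x u"
  have k_cont: "continuous_on {0..t} ?k"
    by (intro continuous_intros continuous_on_subset[OF trajectory_continuous]) auto
  have sup_upper: "weighted_penalty x s \<le> ?sup" if "s \<in> {0..t}" for s
    using that
    by (intro cSUP_upper continuous_on_imp_bdd_above_image weighted_penalty_continuous) auto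
  define B where "B = {s \<in> {0..t}. ?k s \<le> 0}"
  show ?thesis
  proof (cases "B = {}")
    case True
    then have "weighted_norm x t \<le> M * weighted_norm x 0"
      using t by (intro decay_from) (force simp: B_def)+
    moreover have "0 \<le> ?sup"
      using sup_upper[of 0] weighted_penalty_nonneg[of x 0] t by simp
    ultimately show ?thesis by (simp add: penalised_def weighted_norm_def)
  next
    case False
    have "closed B"
      unfolding B_def by (intro continuous_on_closed_Collect_le k_cont continuous_intros)
    moreover have "bounded B"
      by (rule bounded_subset[of "{0..t}"]) (auto simp: B_def)
    ultimately obtain s where s: "s \<in> B" and last: "\<And>u. u \<in> B \<Longrightarrow> u \<le> s"
      using compact_attains_sup[of B] False by (auto simp: compact_eq_bounded_closed)
    have st: "0 \<le> s" "s \<le> t" and bad: "norm (T s x) \<le> \<rho> * norm (C (T s x))"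
      using s by (auto simp: B_def)
    have paid: "M * weighted_norm x s \<le> ?sup"
    proof -
      have "M * norm (T s x) \<le> output_penalty (T s x)"
        unfolding output_penalty_def using bad M_ge_1 by (intro mult_left_mono) auto
      then have "exp (\<mu> * s) * (M * norm (T s x)) \<le> weighted_penalty x s"
        unfolding weighted_penalty_def by (intro mult_left_mono) auto
      also have "\<dots> \<le> ?sup" using st by (intro sup_upper) auto
      finally show ?thesis by (simp add: weighted_norm_def mult_ac)
    qed
    have "weighted_norm x t \<le> M * weighted_norm x s"
    proof (cases "s = t")
      case True
      then show ?thesis
        using mult_right_mono[OF M_ge_1, of "weighted_norm x t"] by (simp add: weighted_norm_def)
    next
      case False
      then have "s < t" using st by simp
      \<comment> \<open>After the last bad time the output is small; by continuity this includes \<open>s\<close> itself.\<close>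
      have "?k u \<ge> 0" if "u \<in> {s..t}" for u
      proof (rule continuous_ge_on_closure[where f = ?k and S = "{s<..t}"])
        show "continuous_on (closure {s<..t}) ?k"
          using k_cont st \<open>s < t\<close> by (auto elim: continuous_on_subset)
        show "u \<in> closure {s<..t}" using that \<open>s < t\<close> by simp
        show "?k v \<ge> 0" if "v \<in> {s<..t}" for v
          using last[of v] that st by (force simp: B_def)
      qed
      then show ?thesis using st by (intro decay_from) auto
    qed
    then have "penalised (weighted_norm x) (weighted_penalty x) 0 t \<le> 0"
      using paid by (simp add: penalised_def)
    also have "0 \<le> M * norm x" using M_ge_1 by simp
    finally show ?thesis .
  qed
qed

lemma penalised_bdd_above_0:
  "bdd_above (penalised (weighted_norm x) (weighted_penalty x) 0 ` {0..})"
  using penalised_le_norm by (auto simp: bdd_above_def)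

lemma penalised_shift_eq:
  assumes "s \<ge> 0" "t \<ge> 0"
  shows "penalised (weighted_norm x) (weighted_penalty x) s (s + t)
    = exp (\<mu> * s) * penalised (weighted_norm (T s x)) (weighted_penalty (T s x)) 0 t"
proof -
  have undo: "exp (\<mu> * s) * (exp (- \<mu> * s) * a) = a" for a :: real
    by (simp add: exp_minus field_simps)
  have norm_undo: "exp (\<mu> * s) * weighted_norm (T s x) r = weighted_norm x (s + r)"
    and penalty_undo: "exp (\<mu> * s) * weighted_penalty (T s x) r = weighted_penalty x (s + r)"
    if "r \<ge> 0" for r
    by (simp_all only: weighted_norm_shift[OF assms(1) that]
        weighted_penalty_shift[OF assms(1) that] undo)
  have "exp (\<mu> * s) * penalised (weighted_norm (T s x)) (weighted_penalty (T s x)) 0 t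
      = penalised (\<lambda>r. exp (\<mu> * s) * weighted_norm (T s x) r)
          (\<lambda>r. exp (\<mu> * s) * weighted_penalty (T s x) r) 0 t"
    using assms weighted_penalty_continuous by (subst penalised_scale) auto
  also have "\<dots> = penalised (\<lambda>r. weighted_norm x (s + r)) (\<lambda>r. weighted_penalty x (s + r)) 0 t"
    unfolding penalised_def using assms
    by (intro arg_cong2[where f = "(-)"] SUP_cong refl)
      (auto simp: norm_undo penalty_undo)
  also have "\<dots> = penalised (weighted_norm x) (weighted_penalty x) s (s + t)"
    by (rule penalised_shift)
  finally show ?thesis ..
qed

lemma penalised_bdd_above:
  assumes s: "s \<ge> 0"
  shows "bdd_above (penalised (weighted_norm x) (weighted_penalty x) s ` {s..})"
proof -
  have "penalised (weighted_norm x) (weighted_penalty x) s t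
      \<le> exp (\<mu> * s) * (M * norm (T s x))" if "t \<ge> s" for t
    using penalised_shift_eq[of s "t - s" x] penalised_le_norm[of "t - s" "T s x"] s that by simp
  then show ?thesis by (auto simp: bdd_above_def)
qed

text \<open>By the semigroup property, reward and charge of the trajectory from \<open>T s x\<close> are those of the
  trajectory from \<open>x\<close>, shifted and rescaled. Hence all values of the function along one trajectory
  come from a single pair of functions of time, started at different times.\<close>

lemma lyapunov_along_trajectory:
  assumes s: "s \<ge> 0"
  shows "lyapunov (T s x) = max (norm (T s x))
    (exp (- \<mu> * s) * penalised_sup (weighted_norm x) (weighted_penalty x) s)"
proof -
  have "exp (- \<mu> * s) * penalised_sup (weighted_norm x) (weighted_penalty x) s
      = penalised_sup (\<lambda>t. exp (- \<mu> * s) * weighted_norm x t)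
          (\<lambda>t. exp (- \<mu> * s) * weighted_penalty x t) s"
    using s penalised_bdd_above weighted_penalty_continuous
    by (subst penalised_sup_scale) auto
  also have "\<dots> = penalised_sup (\<lambda>t. exp (- \<mu> * s) * weighted_norm x (s + t))
          (\<lambda>t. exp (- \<mu> * s) * weighted_penalty x (s + t)) 0"
    by (rule penalised_sup_shift[symmetric])
  also have "\<dots> = penalised_sup (weighted_norm (T s x)) (weighted_penalty (T s x)) 0"
    using s by (intro penalised_sup_cong) (simp_all add: weighted_norm_shift weighted_penalty_shift)
  finally show ?thesis by (simp add: lyapunov_def)
qed

lemma norm_le_lyapunov: "norm x \<le> lyapunov x"
  by (simp add: lyapunov_def)

lemma lyapunov_le_norm: "lyapunov x \<le> M * norm x"
  unfolding lyapunov_def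
  using penalised_sup_least[OF penalised_le_norm] M_ge_1 by (simp add: mult_le_cancel_right1)

lemma lyapunov_scaleR: "lyapunov (a *\<^sub>R x) = \<bar>a\<bar> * lyapunov x"
proof -
  have "weighted_norm (a *\<^sub>R x) = (\<lambda>t. \<bar>a\<bar> * weighted_norm x t)"
    "weighted_penalty (a *\<^sub>R x) = (\<lambda>t. \<bar>a\<bar> * weighted_penalty x t)"
    by (auto simp: fun_eq_iff weighted_norm_def weighted_penalty_def blinfun.scaleR_right
        output_penalty_scaleR)
  then show ?thesis
    unfolding lyapunov_def
    by (simp add: penalised_sup_scale penalised_bdd_above_0 weighted_penalty_continuous
        max_mult_distrib_left)
qed

lemma lyapunov_continuous_along_trajectory: "continuous_on {0..} (\<lambda>t. lyapunov (T t x))"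
proof -
  have "continuous_on {0..} (\<lambda>s. max (norm (T s x))
      (exp (- \<mu> * s) * penalised_sup (weighted_norm x) (weighted_penalty x) s))"
    by (intro continuous_intros trajectory_continuous penalised_sup_continuous_on
        weighted_norm_continuous weighted_penalty_continuous penalised_bdd_above)
  then show ?thesis
    by (rule continuous_on_eq) (simp add: lyapunov_along_trajectory)
qed

lemma weighted_penalty_initially_zero:
  assumes "3 * \<rho> * norm (C x) \<le> norm x"
  shows "eventually (\<lambda>h. \<forall>u\<in>{0..h}. weighted_penalty x u = 0) (at_right 0)"
proof (cases "x = 0")
  case True
  then show ?thesis by (simp add: weighted_penalty_def output_penalty_def)
next
  case False
  let ?d = "\<lambda>t. norm (T t x) - 2 * \<rho> * norm (C (T t x))"
  have "2 * \<rho> * norm (C x) < norm x"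
  proof (cases "C x = 0")
    case False
    then show ?thesis using assms rho_pos by (smt (verit) mult_pos_pos zero_less_norm_iff mult_less_cancel_right)
  qed (use \<open>x \<noteq> 0\<close> in simp)
  then have pos: "?d 0 > 0" by simp
  have "continuous_on {0..} ?d"
    by (intro continuous_intros trajectory_continuous)
  then have "(?d \<longlongrightarrow> ?d 0) (at 0 within {0..})"
    unfolding continuous_on_def by blast
  then have "(?d \<longlongrightarrow> ?d 0) (at_right 0)"
    by (simp add: at_within_Ici_at_right)
  then have "eventually (\<lambda>t. ?d t > 0) (at_right 0)"
    using pos by (rule order_tendstoD)
  then obtain b where b: "b > 0" "\<And>t. 0 < t \<Longrightarrow> t < b \<Longrightarrow> ?d t > 0"
    by (auto simp: eventually_at_right_field)
  show ?thesis
    using eventually_at_right_real[OF b(1)]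
  proof eventually_elim
    case (elim h)
    have "?d u > 0" if "u \<in> {0..h}" for u
      using b(2)[of u] pos that elim by (cases "u = 0") auto
    then show ?case by (fastforce simp: weighted_penalty_def output_penalty_def)
  qed
qed

lemma lyapunov_decrease:
  assumes h: "h \<ge> 0" and free: "\<And>u. u \<in> {0..h} \<Longrightarrow> weighted_penalty x u = 0"
  shows "lyapunov (T h x) \<le> exp (- \<mu> * h) * lyapunov x"
proof -
  let ?W = "penalised_sup (weighted_norm x) (weighted_penalty x)"
  have "weighted_norm x h = penalised (weighted_norm x) (weighted_penalty x) h h"
    using free[of h] h by (simp add: penalised_self)
  also have "\<dots> \<le> ?W h"
    using h penalised_bdd_above by (intro penalised_sup_upper) auto
  finally have "norm (T h x) \<le> exp (- \<mu> * h) * ?W h"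
    by (simp add: weighted_norm_def exp_minus field_simps)
  then have "lyapunov (T h x) = exp (- \<mu> * h) * ?W h"
    using h by (simp add: lyapunov_along_trajectory)
  also have "\<dots> \<le> exp (- \<mu> * h) * ?W 0"
    using h free
    by (intro mult_left_mono penalised_sup_antimono_while_free weighted_penalty_continuous
        weighted_penalty_nonneg penalised_bdd_above_0) auto
  also have "\<dots> \<le> exp (- \<mu> * h) * lyapunov x"
    by (intro mult_left_mono) (auto simp: lyapunov_def)
  finally show ?thesis .
qed

lemma lie_derivative_lyapunov:
  assumes "3 * \<rho> * norm (C x) \<le> norm x"
  shows "lie_derivative T lyapunov x \<le> ereal (- \<mu> * norm x)"
proof -
  let ?q = "\<lambda>h. (exp (- \<mu> * h) - 1) / h * lyapunov x"
  have "((\<lambda>h. exp (- \<mu> * h)) has_real_derivative - \<mu>) (at 0)"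
    by (auto intro!: derivative_eq_intros)
  then have "((\<lambda>h. (exp (- \<mu> * h) - 1) / h) \<longlongrightarrow> - \<mu>) (at_right 0)"
    by (auto simp: has_field_derivative_iff intro: filterlim_mono[OF _ order_refl at_le])
  then have "(?q \<longlongrightarrow> - \<mu> * lyapunov x) (at_right 0)"
    by (intro tendsto_intros)
  then have lim: "Limsup (at_right 0) (\<lambda>h. ereal (?q h)) = ereal (- \<mu> * lyapunov x)"
    by (intro lim_imp_Limsup) auto
  have "lie_derivative T lyapunov x \<le> Limsup (at_right 0) (\<lambda>h. ereal (?q h))"
    unfolding lie_derivative_def mild_solution_def
  proof (rule Limsup_mono)
    show "eventually (\<lambda>h. ereal ((lyapunov (T h x) - lyapunov x) / h) \<le> ereal (?q h)) (at_right 0)"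
      using weighted_penalty_initially_zero[OF assms] eventually_at_right_less[of 0]
    proof eventually_elim
      case (elim h)
      then have "lyapunov (T h x) - lyapunov x \<le> (exp (- \<mu> * h) - 1) * lyapunov x"
        using lyapunov_decrease[of h x] by (simp add: algebra_simps)
      then show ?case using elim by (simp add: divide_right_mono)
    qed
  qed
  also note lim
  also have "ereal (- \<mu> * lyapunov x) \<le> ereal (- \<mu> * norm x)"
    using norm_le_lyapunov[of x] mu_pos by simp
  finally show ?thesis .
qed

lemma eOSS_Lyapunov_lyapunov:
  "eOSS_Lyapunov_impl_with T C 1 (\<lambda>s. 3 * \<rho> * s) lyapunov"
  unfolding eOSS_Lyapunov_impl_with_def mild_solution_def
proof (intro conjI allI)
  show "0 \<le> lyapunov x" for x
    using norm_le_lyapunov[of x] norm_ge_zero[of x] by linarith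
  show "\<exists>k\<^sub>1>0. \<exists>k\<^sub>2>0. \<forall>x. k\<^sub>1 * norm x powr 1 \<le> lyapunov x \<and> lyapunov x \<le> k\<^sub>2 * norm x powr 1"
    using norm_le_lyapunov lyapunov_le_norm M_ge_1
    by (intro exI[of _ 1] exI[of _ M] conjI allI) auto
  show "\<exists>\<alpha>>0. \<forall>x. 3 * \<rho> * norm (C x) \<le> norm x \<longrightarrow>
      lie_derivative T lyapunov x \<le> ereal (- \<alpha> * norm x powr 1)"
    using lie_derivative_lyapunov mu_pos by (intro exI[of _ \<mu>]) auto
qed (use lyapunov_continuous_along_trajectory rho_pos linear_class_K_inf[of "3 * \<rho>"] in auto)

end

lemma UGESMO_imp_Lyapunov:
  assumes T: "C0_semigroup T" and "UGESMO T C"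
  shows "\<exists>V. coercive_eOSS_Lyapunov_impl T C V \<and> abs_homogeneous_1 V \<and>
    (\<exists>\<eta>. linear_gain \<eta> \<and> eOSS_Lyapunov_impl_with T C 1 \<eta> V)"
proof -
  obtain \<rho> M \<mu> where pos: "\<rho> > 0" "M > 0" "\<mu> > 0" and
    decay: "\<And>x \<tau>. \<tau> \<ge> 0 \<Longrightarrow> \<forall>t\<in>{0..\<tau>}. \<rho> * norm (C (T t x)) \<le> norm (T t x) \<Longrightarrow>
      \<forall>t\<in>{0..\<tau>}. norm (T t x) \<le> M * exp (- \<mu> * t) * norm x"
    using assms(2) unfolding UGESMO_def mild_solution_def output_traj_def by blast
  interpret exp_stable_modulo_output T C \<rho> "max 1 M" \<mu>
  proof
    fix x and t :: real
    assume t: "t \<ge> 0"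
      and "\<And>s. s \<in> {0..t} \<Longrightarrow> \<rho> * norm (C (T s x)) \<le> norm (T s x)"
    then have "norm (T t x) \<le> M * exp (- \<mu> * t) * norm x"
      using decay[of t x] by auto
    also have "\<dots> \<le> max 1 M * exp (- \<mu> * t) * norm x"
      by (intro mult_right_mono) auto
    finally show "norm (T t x) \<le> max 1 M * exp (- \<mu> * t) * norm x" .
  qed (use T pos in auto)
  show ?thesis
    using eOSS_Lyapunov_lyapunov lyapunov_scaleR
    unfolding coercive_eOSS_Lyapunov_impl_def abs_homogeneous_1_def linear_gain_def
    by blast
qed

section \<open>Exponential output-to-state stability implies stability modulo output\<close>

text \<open>Scaling the initial state so that the output is bounded by \<open>1\<close> turns any gain \<open>\<gamma>\<close> into the
  linear gain with slope \<open>\<gamma> 1\<close>.\<close>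

lemma eOSS_linear_gain:
  fixes T :: "real \<Rightarrow> 'a::banach \<Rightarrow>\<^sub>L 'a" and C :: "'a \<Rightarrow>\<^sub>L 'b::banach"
  assumes T: "C0_semigroup T" and "eOSS T C"
  obtains M \<mu> c where "M > 0" "\<mu> > 0" "c > 0"
    "\<And>x t B. t \<ge> 0 \<Longrightarrow> B \<ge> 0 \<Longrightarrow> (\<And>s. s \<in> {0..t} \<Longrightarrow> norm (C (T s x)) \<le> B) \<Longrightarrow>
       norm (T t x) \<le> M * exp (- \<mu> * t) * norm x + c * B"
proof -
  obtain M \<mu> \<gamma> where M: "M > 0" "\<mu> > 0" and \<gamma>: "\<gamma> \<in> class_K" and
    bound: "\<And>x t. t \<ge> 0 \<Longrightarrow> norm (T t x)
      \<le> M * exp (- \<mu> * t) * norm x + \<gamma> (SUP s\<in>{0..t}. norm (C (T s x)))"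
    using assms(2) unfolding eOSS_def mild_solution_def output_traj_def by blast
  have \<gamma>0: "\<gamma> 0 = 0" and mono: "\<And>a b. 0 \<le> a \<Longrightarrow> a < b \<Longrightarrow> \<gamma> a < \<gamma> b"
    using \<gamma> by (auto simp: class_K_def strict_mono_on_def)
  have \<gamma>1: "\<gamma> 1 > 0" using mono[of 0 1] \<gamma>0 by simp
  have main: "norm (T t x) \<le> M * exp (- \<mu> * t) * norm x + \<gamma> 1 * B"
    if t: "t \<ge> 0" and B: "B > 0" and out: "\<And>s. s \<in> {0..t} \<Longrightarrow> norm (C (T s x)) \<le> B"
    for x t B
  proof -
    let ?z = "(1 / B) *\<^sub>R x"
    let ?S = "SUP s\<in>{0..t}. norm (C (T s ?z))"
    have le1: "norm (C (T s ?z)) \<le> 1" if "s \<in> {0..t}" for s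
      using out[OF that] B by (simp add: blinfun.scaleR_right)
    have "?S \<le> 1" using t le1 by (intro cSUP_least) auto
    moreover have "0 \<le> ?S"
    proof -
      have "bdd_above ((\<lambda>s. norm (C (T s ?z))) ` {0..t})"
        using le1 by (intro bdd_aboveI2)
      then have "norm (C (T 0 ?z)) \<le> ?S" using t by (intro cSUP_upper) auto
      then show ?thesis using norm_ge_zero order_trans by blast
    qed
    ultimately have "\<gamma> ?S \<le> \<gamma> 1" using mono[of ?S 1] by (cases "?S = 1") auto
    then have "norm (T t ?z) \<le> M * exp (- \<mu> * t) * norm ?z + \<gamma> 1"
      using bound[OF t, of ?z] by linarith
    then have "B * norm (T t ?z) \<le> B * (M * exp (- \<mu> * t) * norm ?z + \<gamma> 1)"
      using B by (intro mult_left_mono) auto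
    then show ?thesis using B by (simp add: blinfun.scaleR_right algebra_simps)
  qed
  have "norm (T t x) \<le> M * exp (- \<mu> * t) * norm x + \<gamma> 1 * B"
    if t: "t \<ge> 0" and B: "B \<ge> 0" and out: "\<And>s. s \<in> {0..t} \<Longrightarrow> norm (C (T s x)) \<le> B"
    for x t B
  \<comment> \<open>Scaling by \<open>1 / B\<close> excludes \<open>B = 0\<close>, which is reached as a limit.\<close>
  proof (rule field_le_epsilon)
    fix e :: real assume e: "e > 0"
    have "norm (T t x) \<le> M * exp (- \<mu> * t) * norm x + \<gamma> 1 * (B + e / \<gamma> 1)"
      using e \<gamma>1 B out by (intro main t add_nonneg_pos) (auto intro: add_increasing2)
    then show "norm (T t x) \<le> M * exp (- \<mu> * t) * norm x + \<gamma> 1 * B + e"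
      using \<gamma>1 by (simp add: algebra_simps)
  qed
  with M \<gamma>1 show ?thesis by (rule that)
qed

text \<open>If the output is at most \<open>\<parallel>x(s)\<parallel> / \<rho>\<close>, the output term in the estimate is at most
  \<open>c / \<rho>\<close> times the maximal state. For large \<open>\<rho>\<close> it is absorbed: first at the time where the
  state is maximal, which bounds the trajectory, and then at a time so large that the transient
  term has become small, which halves the state. Iterating the halving gives exponential decay.\<close>

lemma eOSS_imp_UGESMO:
  fixes T :: "real \<Rightarrow> 'a::banach \<Rightarrow>\<^sub>L 'a" and C :: "'a \<Rightarrow>\<^sub>L 'b::banach"
  assumes T: "C0_semigroup T" and "eOSS T C"
  shows "UGESMO T C"
proof -
  obtain M \<mu> c where pos: "M > 0" "\<mu> > 0" "c > 0" and
    bound: "\<And>x t B. t \<ge> 0 \<Longrightarrow> B \<ge> 0 \<Longrightarrow> (\<And>s. s \<in> {0..t} \<Longrightarrow> norm (C (T s x)) \<le> B) \<Longrightarrow>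
       norm (T t x) \<le> M * exp (- \<mu> * t) * norm x + c * B"
    using eOSS_linear_gain[OF T assms(2)] by blast
  \<comment> \<open>The summand \<open>2\<close> makes \<open>c / \<rho> \<le> 1 / 2\<close>, which absorbs the maximum; the summand \<open>8 M\<close> makes
    \<open>2 M c / \<rho> \<le> 1 / 4\<close>, one half of the state allowed after the halving time.\<close>
  define \<rho> where "\<rho> = c * (2 + 8 * M)"
  have rho: "\<rho> > 0" "c / \<rho> = 1 / (2 + 8 * M)" using pos by (auto simp: \<rho>_def)
  define good where
    "good x \<tau> \<longleftrightarrow> (\<forall>t\<in>{0..\<tau>}. \<rho> * norm (C (T t x)) \<le> norm (T t x))" for x \<tau>
  have small_gain: "norm (T t x) \<le> M * exp (- \<mu> * t) * norm x + B / (2 + 8 * M)"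
    if t: "t \<ge> 0" and "good x t"
      and state_le: "\<And>s. s \<in> {0..t} \<Longrightarrow> norm (T s x) \<le> B" for x t B
  proof -
    have "norm (C (T s x)) \<le> B / \<rho>" if "s \<in> {0..t}" for s
    proof -
      have "\<rho> * norm (C (T s x)) \<le> norm (T s x)"
        using that \<open>good x t\<close> by (simp add: good_def)
      also have "\<dots> \<le> B" using that by (rule state_le)
      finally show ?thesis using rho(1) by (simp add: field_simps)
    qed
    moreover have "B \<ge> 0"
      using state_le[of 0] t norm_ge_zero[of "T 0 x"] by (metis atLeastAtMost_iff order.refl order.trans)
    ultimately have "norm (T t x) \<le> M * exp (- \<mu> * t) * norm x + c * (B / \<rho>)"
      using t rho(1) by (intro bound) auto
    also have "c * (B / \<rho>) = B / (2 + 8 * M)" 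
      using arg_cong[OF rho(2), of "\<lambda>a. a * B"] by simp
    finally show ?thesis .
  qed
  have bounded: "norm (T t x) \<le> 2 * M * norm x" if t: "t \<ge> 0" and "good x t" for x t
  proof -
    have "compact {0..t}" "{0..t} \<noteq> {}" using t by auto
    moreover have "continuous_on {0..t} (\<lambda>s. norm (T s x))"
      by (intro continuous_intros continuous_on_subset[OF C0_semigroup_continuous_on[OF T]]) auto
    ultimately have "\<exists>m\<in>{0..t}. \<forall>s\<in>{0..t}. norm (T s x) \<le> norm (T m x)"
      by (rule continuous_attains_sup)
    then obtain m where m: "m \<in> {0..t}"
      and m_max: "\<forall>s\<in>{0..t}. norm (T s x) \<le> norm (T m x)" ..
    have "norm (T m x) \<le> M * exp (- \<mu> * m) * norm x + norm (T m x) / (2 + 8 * M)"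
      using m m_max \<open>good x t\<close> by (intro small_gain) (auto simp: good_def)
    also have "M * exp (- \<mu> * m) * norm x \<le> M * 1 * norm x"
      using m pos by (intro mult_right_mono mult_left_mono) auto
    also have "norm (T m x) / (2 + 8 * M) \<le> norm (T m x) / 2"
      using pos by (intro divide_left_mono) auto
    finally have "norm (T m x) \<le> 2 * M * norm x" by simp
    then show ?thesis using m_max t by force
  qed
  \<comment> \<open>The transient is at most a quarter from \<open>ln (4 M) / \<mu>\<close> on; the maximum with \<open>1\<close> keeps the
    halving time positive when \<open>4 M \<le> 1\<close>.\<close>
  define t1 where "t1 = max 1 (ln (4 * M) / \<mu>)"
  have t1: "t1 > 0" by (simp add: t1_def)
  have "ln (4 * M) \<le> \<mu> * t1"
    using pos by (simp add: t1_def field_simps max_def)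
  then have "4 * M \<le> exp (\<mu> * t1)"
    using pos exp_le_cancel_iff[of "ln (4 * M)" "\<mu> * t1"] by simp
  then have M_exp: "M * exp (- \<mu> * t1) \<le> 1 / 4"
    by (simp add: exp_minus field_simps)
  have halved: "norm (T t1 x) \<le> norm x / 2" if "good x t1" for x
  proof -
    have "norm (T t1 x) \<le> M * exp (- \<mu> * t1) * norm x + 2 * M * norm x / (2 + 8 * M)"
      using t1 that by (intro small_gain bounded) (auto simp: good_def)
    also have "M * exp (- \<mu> * t1) * norm x \<le> 1 / 4 * norm x"
      using M_exp by (intro mult_right_mono) auto
    also have "2 * M * norm x / (2 + 8 * M) \<le> 1 / 4 * norm x"
      using pos by (simp add: field_simps)
    finally show ?thesis by simp
  qed
  define \<nu> where "\<nu> = ln 2 / t1"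
  have nu: "\<nu> > 0" "\<nu> * t1 = ln 2" using t1 by (auto simp: \<nu>_def)
  have decay: "norm (T t x) \<le> 4 * M * exp (- \<nu> * t) * norm x"
    if "0 \<le> t" "t < real n * t1" "good x t" for n t x
    using that
  proof (induction n arbitrary: t x)
    case (Suc n)
    show ?case
    proof (cases "t \<le> t1")
      case True
      then have "\<nu> * t \<le> ln 2" using nu(1) mult_left_mono[of t t1 \<nu>] by (simp add: nu(2))
      then have "exp (\<nu> * t) \<le> 2" using exp_le_cancel_iff[of "\<nu> * t" "ln 2"] by simp
      then have "1 / 2 \<le> exp (- \<nu> * t)" by (simp add: exp_minus field_simps)
      then have half: "4 * M * (1 / 2) * norm x \<le> 4 * M * exp (- \<nu> * t) * norm x"
        using pos by (intro mult_right_mono mult_left_mono) auto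
      have "norm (T t x) \<le> 4 * M * (1 / 2) * norm x"
        using bounded[of t x] Suc.prems by simp
      also note half
      finally show ?thesis .
    next
      case False
      have sh: "T s (T t1 x) = T (t1 + s) x" if "s \<ge> 0" for s
        using C0_semigroup_shift[OF T, of s t1 x] t1 that by (simp add: add.commute)
      have "norm (T (t - t1) (T t1 x)) \<le> 4 * M * exp (- \<nu> * (t - t1)) * norm (T t1 x)"
        using Suc.prems False t1 by (intro Suc.IH) (auto simp: good_def sh algebra_simps)
      also have "\<dots> \<le> 4 * M * exp (- \<nu> * (t - t1)) * (norm x / 2)"
        using Suc.prems False pos t1 by (intro mult_left_mono halved) (auto simp: good_def)
      also have "exp (- \<nu> * (t - t1)) = exp (- \<nu> * t) * 2"
        using nu by (simp add: algebra_simps exp_add exp_diff exp_minus divide_inverse)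
      finally show ?thesis using sh[of "t - t1"] False by (simp add: mult_ac)
    qed
  qed simp
  have "\<exists>n. t < real n * t1" for t
    using t1 by (metis reals_Archimedean3)
  then have "norm (T t x) \<le> 4 * M * exp (- \<nu> * t) * norm x" if "0 \<le> t" "good x t" for t x
    using decay that by blast
  then have "\<forall>x. \<forall>\<tau>\<ge>0. good x \<tau> \<longrightarrow> (\<forall>t\<in>{0..\<tau>}. norm (T t x) \<le> 4 * M * exp (- \<nu> * t) * norm x)"
    by (auto simp: good_def)
  then show ?thesis
    using rho(1) nu(1) pos(1) unfolding UGESMO_def mild_solution_def output_traj_def good_def
    by (intro exI[of _ \<rho>] exI[of _ "4 * M"] exI[of _ \<nu>] conjI) auto
qed

section \<open>The converse Lyapunov theorem\<close>

theorem theorem3p5: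
  fixes D :: "'a::banach set"
    and A :: "'a \<Rightarrow> 'a"
    and T :: "real \<Rightarrow> 'a \<Rightarrow>\<^sub>L 'a"
    and C :: "'a \<Rightarrow>\<^sub>L 'b::banach"
  assumes "generates_C0_semigroup D A T"
  shows "(UGESMO T C \<longrightarrow>
           (\<exists>V. coercive_eOSS_Lyapunov_impl T C V \<and> abs_homogeneous_1 V \<and>
                (\<exists>\<eta>. linear_gain \<eta> \<and> eOSS_Lyapunov_impl_with T C 1 \<eta> V))) \<and>
         (eOSS T C \<longrightarrow>
           UGESMO T C \<and>
           (\<exists>V. coercive_eOSS_Lyapunov_impl T C V \<and> abs_homogeneous_1 V \<and>
                (\<exists>\<eta>. linear_gain \<eta> \<and> eOSS_Lyapunov_impl_with T C 1 \<eta> V)))"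
proof -
  have "C0_semigroup T" using assms by (simp add: generates_C0_semigroup_def)
  then show ?thesis using UGESMO_imp_Lyapunov eOSS_imp_UGESMO by blast
qed

end
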